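(* Let $n\ge 1$ and let $H_n$ be an $n$-hallway admitting a line of sight. Then there is a rational line of sight $\ell_{\alpha\beta}$ for $H_n$ whose slope can be written $\alpha=\frac{p}{q}$ with $p,q\in\mathbb{Z}$ and $1\le q\leq n$.
   Context: An $n$-hallway is a set $H_n\subset\mathbb{R}^2$ of the form $H_n=\bigcup_{i\in\{0,\ldots,n\}}\{i\}\times(\mathbb{R}\setminus D_i)$, where $D_i=(d_i,d_i+1)$ is an open interval with $d_i\in\mathbb{Z}$ (the $i$th doorway). For $\alpha,\beta\in\mathbb{R}$ let $\ell_{\alpha\beta}=\{(x,\alpha x+\beta):x\in\mathbb{R}\}$. The line $\ell_{\alpha\beta}$ is a line of sight for $H_n$ (and $H_n$ admits the line of sight $\ell_{\alpha\beta}$) if $\ell_{\alpha\beta}\cap H_n=\emptyset$. A line of sight $\ell_{\alpha\beta}$ with $\alpha\in\mathbb{Q}$ is called a rational line of sight. *)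

theory Defs
  imports Complex_Main
begin

definition doorway :: "int \<Rightarrow> real set" where
  "doorway d = {real_of_int d <..< real_of_int d + 1}"

(* A hallway is a bare subset of the plane, represented as real \<times> real; the doorway
   positions d 0, ..., d n are existentially quantified, and values of d beyond n are irrelevant. *)
definition is_hallway :: "nat \<Rightarrow> (real \<times> real) set \<Rightarrow> bool" where
  "is_hallway n H \<longleftrightarrow>
    (\<exists>d :: nat \<Rightarrow> int. H = (\<Union>i\<in>{0..n}. {real i} \<times> (UNIV - doorway (d i))))"

definition line :: "real \<Rightarrow> real \<Rightarrow> (real \<times> real) set" where
  "line \<alpha> \<beta> = {(x, \<alpha> * x + \<beta>) | x. x \<in> UNIV}"

definition line_of_sight :: "(real \<times> real) set \<Rightarrow> real \<Rightarrow> real \<Rightarrow> bool" where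
  "line_of_sight H \<alpha> \<beta> \<longleftrightarrow> line \<alpha> \<beta> \<inter> H = {}"

definition rational_line_of_sight :: "(real \<times> real) set \<Rightarrow> real \<Rightarrow> real \<Rightarrow> bool" where
  "rational_line_of_sight H \<alpha> \<beta> \<longleftrightarrow> line_of_sight H \<alpha> \<beta> \<and> \<alpha> \<in> \<rat>"

end

theory Submission
  imports Defs
begin

text \<open>
  A line \<open>y = \<alpha> x + \<beta>\<close> is a line of sight iff \<open>d i < \<alpha> i + \<beta> < d i + 1\<close> for all \<open>i \<le> n\<close>. In the
  \<open>(\<alpha>, \<beta>)\<close>-plane this is a polygon bounded from below by the lines \<open>\<beta> = d i - \<alpha> i\<close> and from
  above by the lines \<open>\<beta> = d i + 1 - \<alpha> i\<close>; it is bounded because \<open>n \<ge> 1\<close>. Any two of these lines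
  that are not parallel cross at a value of \<open>\<alpha>\<close> that is a fraction with denominator at most
  \<open>n\<close>. None of the lines is vertical, so the leftmost and
  the rightmost point of the polygon are unique; a third vertex lies strictly between them, and
  the vertical line through that vertex meets the interior.

  The proof below turns this picture into a walk that needs no vertices. Start at the slope \<open>a\<close>
  of the given line of sight, and let \<open>i\<close> and \<open>j\<close> be indices whose lines are, at \<open>a\<close>, the highest
  lower bound and the lowest upper bound for \<open>\<beta>\<close>. The gap between these two lines is an
  affine function of the slope, so it does not shrink in at least one of the two directions.
  Walk in that direction to the nearest fraction \<open>s\<close> with denominator at most \<open>n\<close>
  (\<open>bounded_fraction_above\<close>, \<open>bounded_fraction_below\<close>). Two lower bounds, or two upper bounds, can
  exchange their order only at such a fraction, so on the way to \<open>s\<close> the indices \<open>i\<close> and \<open>j\<close>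
  remain extremal (\<open>affine_sign_persists\<close>). Hence the gap at \<open>s\<close> is still positive, and any \<open>\<beta>\<close>
  inside it gives a line of sight with slope \<open>s\<close>.
\<close>

definition bounded_fractions :: "nat \<Rightarrow> real set" where
  "bounded_fractions n = {real_of_int p / real_of_int q | p q. 1 \<le> q \<and> q \<le> int n}"

lemma bounded_fractions_uminus:
  assumes "r \<in> bounded_fractions n"
  shows "- r \<in> bounded_fractions n"
proof -
  obtain p q :: int where "r = real_of_int p / real_of_int q" "1 \<le> q" "q \<le> int n"
    using assms by (auto simp: bounded_fractions_def)
  then have "- r = real_of_int (- p) / real_of_int q" by simp
  then show ?thesis
    using \<open>1 \<le> q\<close> \<open>q \<le> int n\<close> unfolding bounded_fractions_def by blast
qed

lemma bounded_fractions_divide: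
  fixes m e :: int
  assumes "e \<noteq> 0" "\<bar>e\<bar> \<le> int n"
  shows "real_of_int m / real_of_int e \<in> bounded_fractions n"
proof (cases "e > 0")
  case True
  then show ?thesis using assms by (force simp: bounded_fractions_def)
next
  case False
  have "real_of_int m / real_of_int e = real_of_int (- m) / real_of_int (- e)" by simp
  moreover have "1 \<le> - e" "- e \<le> int n" using False assms by auto
  ultimately show ?thesis unfolding bounded_fractions_def by blast
qed

text \<open>
  For each denominator \<open>q\<close> the least fraction not below \<open>a\<close> is \<open>\<lceil>a q\<rceil> / q\<close>, and only finitely many
  denominators compete.
\<close>

lemma bounded_fraction_above:
  assumes "n \<ge> 1"
  obtains s where "s \<in> bounded_fractions n" "a \<le> s"
    "\<And>r. r \<in> bounded_fractions n \<Longrightarrow> a \<le> r \<Longrightarrow> s \<le> r"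
proof -
  define c where "c q = real_of_int \<lceil>a * real_of_int q\<rceil> / real_of_int q" for q
  define s where "s = Min (c ` {1..int n})"
  have "s \<in> c ` {1..int n}"
    unfolding s_def using assms by (intro Min_in) auto
  then obtain q where q: "1 \<le> q" "q \<le> int n" "s = c q" by auto
  show thesis
  proof
    show "s \<in> bounded_fractions n"
      using q unfolding c_def bounded_fractions_def by blast
    show "a \<le> s"
      using q by (simp add: c_def pos_le_divide_eq)
  next
    fix r assume "r \<in> bounded_fractions n" "a \<le> r"
    then obtain p q where r: "r = real_of_int p / real_of_int q" "1 \<le> q" "q \<le> int n"
      by (auto simp: bounded_fractions_def)
    then have "a * real_of_int q \<le> real_of_int p"
      using \<open>a \<le> r\<close> by (simp add: pos_le_divide_eq)
    then have "c q \<le> r"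
      using r unfolding c_def by (simp add: divide_right_mono ceiling_le)
    moreover have "s \<le> c q"
      unfolding s_def using r by (intro Min_le) auto
    ultimately show "s \<le> r" by simp
  qed
qed

lemma bounded_fraction_below:
  assumes "n \<ge> 1"
  obtains s where "s \<in> bounded_fractions n" "s \<le> a"
    "\<And>r. r \<in> bounded_fractions n \<Longrightarrow> r \<le> a \<Longrightarrow> r \<le> s"
proof -
  obtain t where t: "t \<in> bounded_fractions n" "- a \<le> t"
    "\<And>r. r \<in> bounded_fractions n \<Longrightarrow> - a \<le> r \<Longrightarrow> t \<le> r"
    using bounded_fraction_above[OF assms, of "- a"] by blast
  show thesis
  proof
    show "- t \<in> bounded_fractions n" using t(1) by (rule bounded_fractions_uminus)
    show "- t \<le> a" using t(2) by simp
    show "r \<le> - t" if "r \<in> bounded_fractions n" "r \<le> a" for r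
      using t(3)[OF bounded_fractions_uminus[OF that(1)]] that(2) by simp
  qed
qed

text \<open>
  The zero \<open>m / e\<close> of the affine function \<open>m - x e\<close> is a fraction with denominator at most \<open>n\<close>, so
  the function cannot become negative between \<open>a\<close> and \<open>s\<close> if no such fraction lies there.
  Applied to the difference of two lower (or two upper) bounds, this says that their order
  persists. The end point \<open>s\<close> itself may be a zero, which is why the inequalities are weak.
\<close>

lemma affine_sign_persists:
  fixes m e :: int
  assumes gap: "\<And>r. r \<in> bounded_fractions n \<Longrightarrow> \<not> (a \<le> r \<and> r < s) \<and> \<not> (s < r \<and> r \<le> a)"
    and e: "\<bar>e\<bar> \<le> int n"
    and nonneg: "0 \<le> real_of_int m - a * real_of_int e"
  shows "0 \<le> real_of_int m - s * real_of_int e"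
proof (rule ccontr)
  assume neg: "\<not> 0 \<le> real_of_int m - s * real_of_int e"
  then have "e \<noteq> 0" using nonneg by auto
  define r where "r = real_of_int m / real_of_int e"
  have "r \<in> bounded_fractions n"
    unfolding r_def using \<open>e \<noteq> 0\<close> e by (rule bounded_fractions_divide)
  moreover have "a \<le> r \<and> r < s \<or> s < r \<and> r \<le> a"
  proof (cases "e > 0")
    case True
    then show ?thesis
      using neg nonneg by (simp add: r_def pos_le_divide_eq pos_divide_less_eq)
  next
    case False
    then have "e < 0" using \<open>e \<noteq> 0\<close> by simp
    then show ?thesis
      using neg nonneg by (simp add: r_def neg_divide_le_eq neg_less_divide_eq)
  qed
  ultimately show False using gap by blast
qed

lemma line_of_sight_hallway_iff:
  assumes "H = (\<Union>i\<in>{0..n}. {real i} \<times> (UNIV - doorway (d i)))"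
  shows "line_of_sight H \<alpha> \<beta> \<longleftrightarrow>
    (\<forall>i\<le>n. real_of_int (d i) - \<alpha> * real i < \<beta> \<and> \<beta> < real_of_int (d i) + 1 - \<alpha> * real i)"
proof -
  have "line \<alpha> \<beta> \<inter> H =
      (\<lambda>i. (real i, \<alpha> * real i + \<beta>)) ` {i. i \<le> n \<and> \<alpha> * real i + \<beta> \<notin> doorway (d i)}"
    unfolding assms line_def by auto
  then have "line_of_sight H \<alpha> \<beta> \<longleftrightarrow> (\<forall>i\<le>n. \<alpha> * real i + \<beta> \<in> doorway (d i))"
    unfolding line_of_sight_def by simp
  then show ?thesis by (auto simp: doorway_def algebra_simps)
qed

theorem theorem19:
  fixes n :: nat and H :: "(real \<times> real) set"
  assumes "n \<ge> 1"
    and "is_hallway n H"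
    and "\<exists>\<alpha> \<beta>. line_of_sight H \<alpha> \<beta>"
  shows "\<exists>\<alpha> \<beta>. rational_line_of_sight H \<alpha> \<beta> \<and>
           (\<exists>p q :: int. \<alpha> = real_of_int p / real_of_int q \<and> 1 \<le> q \<and> q \<le> int n)"
proof -
  obtain d where H: "H = (\<Union>i\<in>{0..n}. {real i} \<times> (UNIV - doorway (d i)))"
    using assms(2) by (auto simp: is_hallway_def)
  define f where "f x k = real_of_int (d k) - x * real k" for x k
  have sight_iff: "line_of_sight H x b \<longleftrightarrow> (\<forall>k\<le>n. f x k < b \<and> b < f x k + 1)" for x b
    unfolding line_of_sight_hallway_iff[OF H] f_def by (simp add: algebra_simps)
  obtain a b where ab: "\<And>k. k \<le> n \<Longrightarrow> f a k < b \<and> b < f a k + 1"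
    using assms(3) sight_iff by blast
  have "Max (f a ` {..n}) \<in> f a ` {..n}" "Min (f a ` {..n}) \<in> f a ` {..n}"
    by (intro Max_in Min_in; simp)+
  then obtain i j where i: "i \<le> n" "f a i = Max (f a ` {..n})"
    and j: "j \<le> n" "f a j = Min (f a ` {..n})" by (auto simp: image_iff)
  have imax: "f a k \<le> f a i" and jmin: "f a j \<le> f a k" if "k \<le> n" for k
    using that i(2) j(2) by simp_all
  have gap_a: "f a i < f a j + 1"
    using ab[OF i(1)] ab[OF j(1)] by linarith
  \<comment> \<open>The gap at slope \<open>x\<close> is \<open>f x j + 1 - f x i\<close>, with derivative \<open>i - j\<close> in \<open>x\<close>; its sign
      decides the direction.\<close>
  obtain s where s: "s \<in> bounded_fractions n"
    and empty: "\<And>r. r \<in> bounded_fractions n \<Longrightarrow> \<not> (a \<le> r \<and> r < s) \<and> \<not> (s < r \<and> r \<le> a)"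
    and dir: "0 \<le> (s - a) * (real i - real j)"
  proof (cases "j \<le> i")
    case True
    obtain s where "s \<in> bounded_fractions n" "a \<le> s"
      "\<And>r. r \<in> bounded_fractions n \<Longrightarrow> a \<le> r \<Longrightarrow> s \<le> r"
      using bounded_fraction_above[OF assms(1), of a] by blast
    then show thesis using True by (intro that[of s]) (force intro: mult_nonneg_nonneg)+
  next
    case False
    obtain s where "s \<in> bounded_fractions n" "s \<le> a"
      "\<And>r. r \<in> bounded_fractions n \<Longrightarrow> r \<le> a \<Longrightarrow> r \<le> s"
      using bounded_fraction_below[OF assms(1), of a] by blast
    then show thesis using False by (intro that[of s]) (force intro: mult_nonpos_nonpos)+
  qed
  have order_persists: "f s l \<le> f s k" if "k \<le> n" "l \<le> n" "f a l \<le> f a k" for k l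
    using affine_sign_persists[OF empty, where e = "int k - int l" and m = "d k - d l"] that
    by (auto simp: f_def algebra_simps)
  have gap_s: "f s i < f s j + 1"
    using gap_a dir by (simp add: f_def algebra_simps)
  define t where "t = (f s i + (f s j + 1)) / 2"
  have "f s k < t \<and> t < f s k + 1" if "k \<le> n" for k
    using order_persists[OF i(1) that imax[OF that]]
      order_persists[OF that j(1) jmin[OF that]] gap_s
    by (simp add: t_def)
  then have "line_of_sight H s t" by (simp add: sight_iff)
  moreover obtain p q :: int where pq: "s = real_of_int p / real_of_int q" "1 \<le> q" "q \<le> int n"
    using s by (auto simp: bounded_fractions_def)
  moreover have "s \<in> \<rat>" unfolding pq(1) by simp
  ultimately show ?thesis unfolding rational_line_of_sight_def by blast
qed

end
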